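(* Let $X$ be an Archimedean pervasive pre-Riesz space and $(Y,i)$ a vector lattice cover of $X$. Let $a\in X$. (i) $a\in\mathcal A_X$ if and only if $i(a)\in\mathcal A_Y$. (ii) $a$ is discrete in $X$ if and only if $i(a)$ is discrete in $Y$. (iii) $a\in\mathcal A_X$ if and only if $a$ is a discrete element of $X$. (iv) If $a\in\mathcal A_X$, then $i(\mathcal I_a)=\mathcal I_{i(a)}$. (v) If $\tilde a\in\mathcal A_Y$, then $\tilde a\in i(X)$ and $i^{-1}(\tilde a)\in\mathcal A_X$.
   Context: All vector spaces are real. An ordered vector space $X$ is a real vector space with a cone $X_+$ (closed under addition and multiplication by nonnegative scalars, $X_+\cap(-X_+)=\{0\}$), ordered by $x\le y$ iff $y-x\in X_+$. It is Archimedean if $nx\le y$ for all $n\in\mathbb N$ implies $x\le 0$. A linear subspace $D$ of an ordered vector space $Y$ is order dense in $Y$ if $y=\inf\{z\in D: y\le z\}$ for every $y\in Y$. An ordered vector space $X$ is a pre-Riesz space if there exist a vector lattice $Y$ and a bipositive linear map $i\colon X\to Y$ (i.e. $i(x)\ge 0$ iff $x\ge 0$) such that $i(X)$ is order dense in $Y$; then $(Y,i)$ is called a vector lattice cover of $X$. A pre-Riesz space $X$ is pervasive if for some (equivalently, every) vector lattice cover $(Y,i)$ of $X$, for every $y\in Y_+$ with $y\ne 0$ there is $x\in X$ with $0<i(x)\le y$. The following definitions apply to any ordered vector space, in particular to $X$ and to $Y$. For $M\subseteq X$, $M^u$ is the set of upper bounds of $M$ in $X$. Elements $x,y\in X$ are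 disjoint, $x\perp y$, if $\{x+y,-x-y\}^u=\{x-y,-x+y\}^u$ (in a vector lattice this is the usual disjointness). An element $a\in X_+\setminus\{0\}$ is an atom if $0\le x\le a$ implies $x=\lambda a$ for some real $\lambda\ge 0$; $\mathcal A_X$ is the set of all atoms of $X$. An element $a\in X$, $a>0$, is discrete if for all $x,z\in X_+$ with $x,z\le a$ and $x\perp z$ it follows that $x=0$ or $z=0$. A subset $M\subseteq X$ is solid if for all $x\in X$, $y\in M$ the inclusion $\{x,-x\}^u\supseteq\{y,-y\}^u$ implies $x\in M$; an ideal is a solid linear subspace. $\mathcal I_a$ denotes the intersection of all ideals containing $a$ (in $X$ for $a\in X$, in $Y$ for elements of $Y$). *)

theory Defs
  imports Complex_Main "HOL-Library.Lub_Glb" "HOL-Library.Lattice_Algebras"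
begin

text \<open>
  Ordered vector spaces are the types of class \<^class>\<open>ordered_real_vector\<close>; the cone is
  \<open>{x. 0 \<le> x}\<close>. No directedness (generating cone) is built in. The set of upper bounds of \<open>M\<close>
  in the whole space is \<^term>\<open>ubs UNIV M\<close>.
\<close>

class vector_lattice = ordered_real_vector + lattice
begin

subclass lattice_ab_group_add ..

end

instance real :: vector_lattice ..

definition archimedean_ovs :: "'a::ordered_real_vector itself \<Rightarrow> bool" where
  "archimedean_ovs _ \<longleftrightarrow> (\<forall>x y::'a. (\<forall>n::nat. real n *\<^sub>R x \<le> y) \<longrightarrow> x \<le> 0)"

definition order_dense :: "'a::ordered_real_vector set \<Rightarrow> bool" where
  "order_dense D \<longleftrightarrow> subspace D \<and> (\<forall>y. isGlb UNIV {z \<in> D. y \<le> z} y)"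

definition bipositive :: "('a::ordered_real_vector \<Rightarrow> 'b::ordered_real_vector) \<Rightarrow> bool" where
  "bipositive f \<longleftrightarrow> (\<forall>x. 0 \<le> f x \<longleftrightarrow> 0 \<le> x)"

definition vector_lattice_cover :: "('a::ordered_real_vector \<Rightarrow> 'b::vector_lattice) \<Rightarrow> bool" where
  "vector_lattice_cover i \<longleftrightarrow> linear i \<and> bipositive i \<and> order_dense (range i)"

text \<open>
  A space is pre-Riesz if it has some vector lattice cover, and pervasive if moreover some cover
  satisfies the condition below. HOL cannot quantify existentially over the type \<open>'b\<close> of the cover
  inside a formula, so the predicate takes the cover as an argument. As a hypothesis
  \<open>pervasive_via j\<close> with an otherwise unconstrained \<open>j\<close> and \<open>'b\<close>, it says exactly that \<open>'a\<close> is a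
  pervasive pre-Riesz space.
\<close>

definition pervasive_via :: "('a::ordered_real_vector \<Rightarrow> 'b::vector_lattice) \<Rightarrow> bool" where
  "pervasive_via j \<longleftrightarrow>
     vector_lattice_cover j \<and> (\<forall>y. 0 \<le> y \<and> y \<noteq> 0 \<longrightarrow> (\<exists>x. 0 < j x \<and> j x \<le> y))"

definition disjoint_elems :: "'a::ordered_real_vector \<Rightarrow> 'a \<Rightarrow> bool" where
  "disjoint_elems x y \<longleftrightarrow> ubs UNIV {x + y, - x - y} = ubs UNIV {x - y, - x + y}"

definition atoms :: "'a::ordered_real_vector set" where
  "atoms = {a. 0 \<le> a \<and> a \<noteq> 0 \<and> (\<forall>x. 0 \<le> x \<and> x \<le> a \<longrightarrow> (\<exists>c::real. 0 \<le> c \<and> x = c *\<^sub>R a))}"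

definition discrete_elem :: "'a::ordered_real_vector \<Rightarrow> bool" where
  "discrete_elem a \<longleftrightarrow> 0 < a \<and>
     (\<forall>x z. 0 \<le> x \<and> 0 \<le> z \<and> x \<le> a \<and> z \<le> a \<and> disjoint_elems x z \<longrightarrow> x = 0 \<or> z = 0)"

definition solid :: "'a::ordered_real_vector set \<Rightarrow> bool" where
  "solid M \<longleftrightarrow> (\<forall>x. \<forall>y\<in>M. ubs UNIV {y, - y} \<subseteq> ubs UNIV {x, - x} \<longrightarrow> x \<in> M)"

definition order_ideal :: "'a::ordered_real_vector set \<Rightarrow> bool" where
  "order_ideal M \<longleftrightarrow> subspace M \<and> solid M"

definition ideal_of :: "'a::ordered_real_vector \<Rightarrow> 'a set" where
  "ideal_of a = \<Inter> {M. order_ideal M \<and> a \<in> M}"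

end

theory Submission
  imports Defs
begin

text \<open>
  Write \<open>X\<close> for the Archimedean pervasive pre-Riesz space and \<open>i : X \<rightarrow> Y\<close> for the cover. The
  equivalences between atoms and discrete elements follow from one cycle of implications:
  \<open>a\<close> is an atom of \<open>X\<close>; \<open>a\<close> is discrete in \<open>X\<close>; \<open>i a\<close> is discrete in \<open>Y\<close>; \<open>i a\<close> is an atom
  of \<open>Y\<close>; \<open>a\<close> is an atom of \<open>X\<close>. The first step holds in every ordered vector space
  (\<open>atom_imp_discrete\<close>), because two multiples of \<open>a\<close> are disjoint only if one of them vanishes.
  The second uses pervasiveness (\<open>discrete_imp_discrete_cover\<close>): below two nonzero disjoint
  elements of \<open>[0, i a]\<close> lie nonzero images of elements of \<open>X\<close>, and these are disjoint as well.
  The third is the classical fact that discrete elements of an Archimedean vector lattice are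
  atoms (\<open>discrete_imp_atom\<close>): for \<open>0 \<le> y \<le> a\<close> and \<open>0 \<le> t \<le> 1\<close>, the positive and negative parts of
  \<open>y - t a\<close> are disjoint elements of \<open>[0, a]\<close>, so \<open>y\<close> is comparable with every \<open>t a\<close>, and \<open>y = s a\<close>
  for the supremum \<open>s\<close> of all \<open>t\<close> with \<open>t a \<le> y\<close>. The last step is immediate from bipositivity.

  Two transfer results make this applicable to an arbitrary cover: every cover of an Archimedean
  space is Archimedean (\<open>cover_archimedean\<close>), and pervasiveness does not depend on the cover
  (\<open>pervasive_cover_independent\<close>), since it can be expressed in \<open>X\<close> alone.

  In every ordered vector space, the ideal generated by an atom \<open>a\<close> is the line spanned by \<open>a\<close>
  (\<open>ideal_of_atom\<close>), and linear maps carry lines to lines. Finally, an atom \<open>b\<close> of \<open>Y\<close>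
  has some \<open>i x\<close> with \<open>0 < i x \<le> b\<close> below it, which is a positive multiple of \<open>b\<close>; hence \<open>b\<close> lies
  in the range of \<open>i\<close>.
\<close>

section \<open>Ordered vector spaces\<close>

lemma mem_ubs_pair: "z \<in> ubs UNIV {x, y} \<longleftrightarrow> x \<le> z \<and> y \<le> z"
  by (auto simp: ubs_def isUb_def setle_def)

lemma scaleR_le_scaleR_imp_le:
  fixes a :: "'a::ordered_real_vector"
  assumes "0 < a" and "s *\<^sub>R a \<le> t *\<^sub>R a"
  shows "s \<le> t"
proof (rule ccontr)
  assume "\<not> s \<le> t"
  moreover have "(s - t) *\<^sub>R a \<le> 0"
    using assms(2) by (simp add: scaleR_left_diff_distrib)
  ultimately have "a \<le> 0" by (simp add: scaleR_le_0_iff)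
  with assms(1) show False by simp
qed

lemma archimedean_le_zeroI:
  fixes w u :: "'a::ordered_real_vector"
  assumes "archimedean_ovs TYPE('a)" and "\<And>e::real. 0 < e \<Longrightarrow> w \<le> e *\<^sub>R u"
  shows "w \<le> 0"
proof -
  have "real (Suc n) *\<^sub>R w \<le> u" for n
  proof -
    have "real (Suc n) *\<^sub>R w \<le> real (Suc n) *\<^sub>R (inverse (real (Suc n)) *\<^sub>R u)"
      by (intro scaleR_left_mono assms(2)) simp_all
    then show ?thesis by (simp del: of_nat_Suc)
  qed
  \<comment> \<open>The Archimedean property also asks for the multiple zero, hence the bound \<open>u - w\<close>.\<close>
  then have "real n *\<^sub>R w \<le> u - w" for n
    by (simp add: algebra_simps)
  then show ?thesis using assms(1) unfolding archimedean_ovs_def by blast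
qed

lemma atomD:
  fixes a :: "'a::ordered_real_vector"
  assumes "a \<in> atoms" "0 \<le> x" "x \<le> a"
  obtains c :: real where "0 \<le> c" "x = c *\<^sub>R a"
  using assms by (auto simp: atoms_def)

lemma atom_pos: "a \<in> atoms \<Longrightarrow> 0 < a"
  by (auto simp: atoms_def)

lemma disjoint_multiples_imp_zero:
  fixes a :: "'a::ordered_real_vector"
  assumes "0 < a" "0 \<le> s" "0 \<le> t" and disj: "disjoint_elems (s *\<^sub>R a) (t *\<^sub>R a)"
  shows "s = 0 \<or> t = 0"
proof -
  have "\<bar>s - t\<bar> *\<^sub>R a \<in> ubs UNIV {s *\<^sub>R a - t *\<^sub>R a, - (s *\<^sub>R a) + t *\<^sub>R a}"
    using assms(1)
    by (auto simp: mem_ubs_pair scaleR_right_mono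
        simp flip: scaleR_left_diff_distrib scaleR_minus_left scaleR_left_distrib)
  then have "s *\<^sub>R a + t *\<^sub>R a \<le> \<bar>s - t\<bar> *\<^sub>R a"
    using disj by (auto simp: disjoint_elems_def mem_ubs_pair)
  then have "s + t \<le> \<bar>s - t\<bar>"
    using scaleR_le_scaleR_imp_le[OF assms(1), of "s + t"] by (simp add: scaleR_left_distrib)
  with assms(2,3) show ?thesis by linarith
qed

lemma atom_imp_discrete:
  fixes a :: "'a::ordered_real_vector"
  assumes "a \<in> atoms"
  shows "discrete_elem a"
  unfolding discrete_elem_def
proof (intro conjI allI impI)
  show "0 < a" using assms by (rule atom_pos)
next
  fix x z :: 'a
  assume h: "0 \<le> x \<and> 0 \<le> z \<and> x \<le> a \<and> z \<le> a \<and> disjoint_elems x z"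
  obtain s where s: "0 \<le> s" "x = s *\<^sub>R a" using h by (blast intro: atomD[OF assms])
  obtain t where t: "0 \<le> t" "z = t *\<^sub>R a" using h by (blast intro: atomD[OF assms])
  show "x = 0 \<or> z = 0"
    using disjoint_multiples_imp_zero[OF atom_pos[OF assms] s(1) t(1)] h s t by auto
qed

lemma scaleR_atom:
  fixes a :: "'a::ordered_real_vector"
  assumes "a \<in> atoms" and "0 < c"
  shows "c *\<^sub>R a \<in> atoms"
  unfolding atoms_def
proof (intro CollectI conjI allI impI)
  show "0 \<le> c *\<^sub>R a" using assms by (simp add: atoms_def scaleR_nonneg_nonneg)
  show "c *\<^sub>R a \<noteq> 0" using assms by (simp add: atoms_def)
next
  fix x :: 'a
  assume x: "0 \<le> x \<and> x \<le> c *\<^sub>R a"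
  have "x /\<^sub>R c \<le> (c *\<^sub>R a) /\<^sub>R c"
    using x assms(2) by (intro scaleR_left_mono) auto
  then have "x /\<^sub>R c \<le> a" using assms(2) by simp
  moreover have "0 \<le> x /\<^sub>R c" using x assms(2) by (simp add: scaleR_nonneg_nonneg)
  ultimately obtain d where d: "0 \<le> d" "x /\<^sub>R c = d *\<^sub>R a"
    using atomD[OF assms(1)] by blast
  have "x = c *\<^sub>R (x /\<^sub>R c)" using assms(2) by simp
  also have "\<dots> = d *\<^sub>R (c *\<^sub>R a)" unfolding d(2) by (rule scaleR_left_commute)
  finally show "\<exists>d\<ge>0. x = d *\<^sub>R (c *\<^sub>R a)" using d(1) by blast
qed

lemma solid_span_atom:
  fixes a :: "'a::ordered_real_vector"
  assumes "a \<in> atoms"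
  shows "solid (span {a})"
  unfolding solid_def
proof (intro allI ballI impI)
  fix x y :: 'a
  assume "y \<in> span {a}" and sub: "ubs UNIV {y, - y} \<subseteq> ubs UNIV {x, - x}"
  then obtain c where c: "y = c *\<^sub>R a" by (auto simp: span_singleton)
  have "\<bar>c\<bar> *\<^sub>R a \<in> ubs UNIV {y, - y}"
    using atom_pos[OF assms] unfolding c
    by (auto simp: mem_ubs_pair scaleR_right_mono simp flip: scaleR_minus_left)
  with sub have x: "x \<le> \<bar>c\<bar> *\<^sub>R a" "- x \<le> \<bar>c\<bar> *\<^sub>R a"
    by (auto simp: mem_ubs_pair)
  show "x \<in> span {a}"
  proof (cases "c = 0")
    case True
    with x have "x = 0" by (auto intro: order.antisym)
    then show ?thesis by (simp add: span_zero)
  next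
    case False
    \<comment> \<open>Shifting \<open>x\<close> by \<open>\<bar>c\<bar> a\<close> places it in the interval below the atom \<open>2 \<bar>c\<bar> a\<close>.\<close>
    have atom: "(2 * \<bar>c\<bar>) *\<^sub>R a \<in> atoms"
      using assms False by (intro scaleR_atom) auto
    have pos: "0 \<le> x + \<bar>c\<bar> *\<^sub>R a" using add_left_mono[OF x(2), of x] by simp
    have "x + \<bar>c\<bar> *\<^sub>R a \<le> \<bar>c\<bar> *\<^sub>R a + \<bar>c\<bar> *\<^sub>R a"
      using x(1) by (rule add_right_mono)
    also have "\<dots> = (2 * \<bar>c\<bar>) *\<^sub>R a" by (simp flip: scaleR_left_distrib)
    finally obtain d where "x + \<bar>c\<bar> *\<^sub>R a = d *\<^sub>R ((2 * \<bar>c\<bar>) *\<^sub>R a)"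
      using atomD[OF atom pos] by blast
    then have "x = (d * (2 * \<bar>c\<bar>) - \<bar>c\<bar>) *\<^sub>R a"
      by (simp add: scaleR_left_diff_distrib eq_diff_eq)
    then show ?thesis by (auto simp: span_singleton)
  qed
qed

lemma ideal_of_atom:
  fixes a :: "'a::ordered_real_vector"
  assumes "a \<in> atoms"
  shows "ideal_of a = span {a}"
proof
  show "ideal_of a \<subseteq> span {a}"
    using solid_span_atom[OF assms]
    by (auto simp: ideal_of_def order_ideal_def intro: span_base)
  show "span {a} \<subseteq> ideal_of a"
    by (auto simp: ideal_of_def order_ideal_def dest: span_minimal[of "{a}", rotated])
qed

section \<open>Vector lattices\<close>

lemma inf_zero_imp_disjoint:
  fixes u v :: "'a::vector_lattice"
  assumes "0 \<le> u" "0 \<le> v" "inf u v = 0"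
  shows "disjoint_elems u v"
proof -
  have sum: "sup u v = u + v" using add_eq_inf_sup[of u v] assms(3) by simp
  have "u + v \<le> w \<and> - u - v \<le> w \<longleftrightarrow> u - v \<le> w \<and> - u + v \<le> w" for w
  proof (intro iffI)
    assume w: "u + v \<le> w \<and> - u - v \<le> w"
    have "u - v \<le> u + v" "- u + v \<le> u + v"
      using assms(1,2) add_mono[OF order.refl[of u], of "- v" v]
        add_mono[OF _ order.refl[of v], of "- u" u]
      by (simp_all add: minus_le_self_iff)
    with w show "u - v \<le> w \<and> - u + v \<le> w" by (meson order.trans)
  next
    assume w: "u - v \<le> w \<and> - u + v \<le> w"
    have "(u - v) + (- u + v) \<le> w + w" using w by (intro add_mono) auto
    then have w0: "0 \<le> w" by simp
    have "u \<le> w + v" "v \<le> w + u" using w by (simp_all add: algebra_simps)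
    moreover have "u \<le> w + u" "v \<le> w + v" using w0 by simp_all
    ultimately have "sup u v \<le> w + u" "sup u v \<le> w + v" by simp_all
    then have "v \<le> w" "u \<le> w" unfolding sum by simp_all
    then have "u + v \<le> w" using sum by (metis le_supI)
    moreover have "- u - v \<le> u + v"
      using add_nonneg_nonneg[OF assms(1,2)] minus_le_self_iff[of "u + v"]
      by (simp add: algebra_simps)
    ultimately show "u + v \<le> w \<and> - u - v \<le> w" by (meson order.trans)
  qed
  then show ?thesis by (simp add: disjoint_elems_def set_eq_iff mem_ubs_pair)
qed

lemma disjoint_positive_imp_inf_zero:
  fixes u v :: "'a::vector_lattice"
  assumes "disjoint_elems u v" "0 \<le> u" "0 \<le> v"
  shows "inf u v = 0"
proof -
  have "sup (u - v) (v - u) \<in> ubs UNIV {u - v, - u + v}"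
    by (simp add: mem_ubs_pair)
  then have "u + v \<le> sup (u - v) (v - u)"
    using assms(1) by (auto simp: disjoint_elems_def mem_ubs_pair)
  also have "\<dots> \<le> u + v - inf u v"
  proof (rule sup_least)
    have "inf u v \<le> v + v" "inf u v \<le> u + u"
      using assms(2,3) by (metis add_increasing inf.coboundedI1 inf.coboundedI2 order.refl)+
    then have "u - v + inf u v \<le> u - v + (v + v)" "v - u + inf u v \<le> v - u + (u + u)"
      by (simp_all only: add_le_cancel_left)
    then show "u - v \<le> u + v - inf u v" "v - u \<le> u + v - inf u v"
      unfolding le_diff_eq by (simp_all add: add.commute add.left_commute)
  qed
  finally have "inf u v \<le> 0" unfolding le_diff_eq by simp
  with assms(2,3) show ?thesis by (simp add: order.antisym)
qed

lemma inf_positive_negative_part: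
  fixes x :: "'a::vector_lattice"
  shows "inf (sup x 0) (sup (- x) 0) = 0"
proof -
  have "sup (- x) 0 = sup x 0 + (- x)"
    using add_sup_distrib_right[of x 0 "- x"] by (simp add: sup_commute)
  then have "inf (sup x 0) (sup (- x) 0) = sup x 0 + inf 0 (- x)"
    by (simp add: add_inf_distrib_left)
  also have "inf 0 (- x) = - sup x 0"
    by (simp add: neg_sup_eq_inf inf_commute)
  finally show ?thesis by (simp only: add.right_inverse)
qed

lemma discrete_comparable:
  fixes a :: "'a::vector_lattice"
  assumes disc: "discrete_elem a" and y: "0 \<le> y" "y \<le> a" and z: "0 \<le> z" "z \<le> a"
  shows "y \<le> z \<or> z \<le> y"
proof -
  let ?p = "sup (y - z) 0" and ?q = "sup (- (y - z)) 0"
  have "disjoint_elems ?p ?q"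
    by (rule inf_zero_imp_disjoint) (simp_all only: inf_positive_negative_part sup_ge2)
  moreover have "y - z \<le> a" using diff_mono[OF y(2) z(1)] by simp
  moreover have "- (y - z) \<le> a" using diff_mono[OF z(2) y(1)] by simp
  moreover have "0 \<le> a" using y by (rule order.trans)
  ultimately have "?p = 0 \<or> ?q = 0"
    using disc unfolding discrete_elem_def by (metis le_supI sup_ge2)
  then show ?thesis by (metis diff_le_0_iff_le minus_diff_eq sup_ge1)
qed

lemma discrete_imp_atom:
  fixes a :: "'a::vector_lattice"
  assumes arch: "archimedean_ovs TYPE('a)" and disc: "discrete_elem a"
  shows "a \<in> atoms"
proof -
  have a: "0 < a" using disc by (simp add: discrete_elem_def)
  have "\<exists>c\<ge>0. y = c *\<^sub>R a" if y: "0 \<le> y" "y \<le> a" for y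
  proof -
    define S where "S = {t::real. 0 \<le> t \<and> t \<le> 1 \<and> t *\<^sub>R a \<le> y}"
    have bdd: "bdd_above S" by (auto simp: S_def)
    have "0 \<in> S" using y by (simp add: S_def)
    then have s0: "0 \<le> Sup S" and ne: "S \<noteq> {}" using bdd by (auto intro: cSup_upper)
    have "y - Sup S *\<^sub>R a \<le> e *\<^sub>R a" if e: "0 < e" for e
    proof -
      have "y \<le> (Sup S + e) *\<^sub>R a"
      proof (cases "Sup S + e \<le> 1")
        case True
        have "Sup S + e \<notin> S" using cSup_upper[OF _ bdd] e by fastforce
        then have "\<not> (Sup S + e) *\<^sub>R a \<le> y" using True s0 e by (simp add: S_def)
        moreover have "0 \<le> (Sup S + e) *\<^sub>R a" "(Sup S + e) *\<^sub>R a \<le> a"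
          using a s0 e True by (simp_all add: scaleR_nonneg_nonneg scaleR_left_le_one_le)
        ultimately show ?thesis using discrete_comparable[OF disc y] by blast
      next
        case False
        then have "1 *\<^sub>R a \<le> (Sup S + e) *\<^sub>R a" using a by (intro scaleR_right_mono) auto
        with y(2) show ?thesis by simp
      qed
      then show ?thesis by (simp add: algebra_simps)
    qed
    then have "y - Sup S *\<^sub>R a \<le> 0" by (rule archimedean_le_zeroI[OF arch])
    moreover have "Sup S *\<^sub>R a - y \<le> e *\<^sub>R a" if e: "0 < e" for e
    proof -
      have "Sup S - e < Sup S" using e by simp
      then obtain t where t: "t \<in> S" "Sup S - e < t"
        using less_cSup_iff[OF ne bdd] by blast
      have "(Sup S - e) *\<^sub>R a \<le> t *\<^sub>R a" using t a by (intro scaleR_right_mono) auto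
      also have "\<dots> \<le> y" using t by (simp add: S_def)
      finally show ?thesis by (simp add: algebra_simps)
    qed
    then have "Sup S *\<^sub>R a - y \<le> 0" by (rule archimedean_le_zeroI[OF arch])
    ultimately have "y = Sup S *\<^sub>R a" by (simp add: order.antisym)
    with s0 show ?thesis by blast
  qed
  with a show ?thesis by (auto simp: atoms_def)
qed

section \<open>Vector lattice covers\<close>

lemma cover_linear: "vector_lattice_cover i \<Longrightarrow> linear i"
  by (simp add: vector_lattice_cover_def)

lemma cover_le_iff:
  assumes "vector_lattice_cover i"
  shows "i x \<le> i y \<longleftrightarrow> x \<le> y"
proof -
  have "0 \<le> i (y - x) \<longleftrightarrow> 0 \<le> y - x"
    using assms by (simp add: vector_lattice_cover_def bipositive_def)
  then show ?thesis by (simp add: linear_diff[OF cover_linear[OF assms]])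
qed

lemma cover_eq_iff:
  assumes "vector_lattice_cover i"
  shows "i x = i y \<longleftrightarrow> x = y"
  using cover_le_iff[OF assms] by (metis order.antisym order.refl)

lemma cover_zero: "vector_lattice_cover i \<Longrightarrow> i 0 = 0"
  by (simp add: cover_linear linear_0)

lemma cover_less_zero_iff: "vector_lattice_cover i \<Longrightarrow> 0 < i x \<longleftrightarrow> 0 < x"
  by (metis cover_le_iff cover_zero less_le_not_le)

text \<open>Order density: every \<open>y\<close> in the cover is the infimum of the images above it and, by passing
  to negatives, the supremum of the images below it.\<close>

lemma cover_le_infI:
  assumes cover: "vector_lattice_cover i" and "\<And>z. y \<le> i z \<Longrightarrow> w \<le> i z"
  shows "w \<le> y"
proof -
  have "isGlb UNIV {z \<in> range i. y \<le> z} y"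
    using cover by (simp add: vector_lattice_cover_def order_dense_def)
  then have "\<And>w. (\<And>z. z \<in> range i \<Longrightarrow> y \<le> z \<Longrightarrow> w \<le> z) \<Longrightarrow> w \<le> y"
    by (auto simp: isGlb_def greatestP_def isLb_def setge_def setle_def)
  then show ?thesis using assms(2) by blast
qed

lemma cover_sup_leI:
  assumes cover: "vector_lattice_cover i" and "\<And>z. i z \<le> y \<Longrightarrow> i z \<le> w"
  shows "y \<le> w"
proof -
  have "- w \<le> - y"
  proof (rule cover_le_infI[OF cover])
    fix z assume "- y \<le> i z"
    then have "i (- z) \<le> y" by (simp add: linear_neg[OF cover_linear[OF cover]] minus_le_iff)
    then have "i (- z) \<le> w" by (rule assms(2))
    then show "- w \<le> i z" by (simp add: linear_neg[OF cover_linear[OF cover]] minus_le_iff)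
  qed
  then show ?thesis by simp
qed

lemma cover_majorizing:
  assumes cover: "vector_lattice_cover i"
  shows "\<exists>z. y \<le> i z"
proof (rule ccontr)
  assume none: "\<nexists>z. y \<le> i z"
  \<comment> \<open>Otherwise \<open>y\<close> is the infimum of the empty set, that is, the greatest element.\<close>
  then have "y + y \<le> y" by (blast intro: cover_le_infI[OF cover])
  then have "y \<le> i 0" by (simp add: cover_zero[OF cover])
  with none show False by blast
qed

lemma cover_archimedean:
  fixes i :: "'x::ordered_real_vector \<Rightarrow> 'y::vector_lattice"
  assumes cover: "vector_lattice_cover i" and arch: "archimedean_ovs TYPE('x)"
  shows "archimedean_ovs TYPE('y)"
  unfolding archimedean_ovs_def
proof (intro allI impI)
  fix y w :: 'y
  assume y: "\<forall>n. real n *\<^sub>R y \<le> w"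
  obtain z where z: "w \<le> i z" using cover_majorizing[OF cover] by blast
  show "y \<le> 0"
  proof (rule cover_sup_leI[OF cover])
    fix x assume x: "i x \<le> y"
    have "real n *\<^sub>R x \<le> z" for n
    proof -
      have "i (real n *\<^sub>R x) = real n *\<^sub>R i x"
        by (rule linear_cmul[OF cover_linear[OF cover]])
      also have "\<dots> \<le> real n *\<^sub>R y" using x by (intro scaleR_left_mono) auto
      also have "\<dots> \<le> i z" using y z by (blast intro: order.trans)
      finally show ?thesis by (simp add: cover_le_iff[OF cover])
    qed
    then have "x \<le> 0" using arch unfolding archimedean_ovs_def by blast
    then show "i x \<le> 0" by (metis cover_le_iff[OF cover] cover_zero[OF cover])
  qed
qed

lemma cover_le_positive_part_iff:
  assumes cover: "vector_lattice_cover i"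
  shows "i x \<le> sup (i a) 0 \<longleftrightarrow> (\<forall>z. a \<le> z \<and> 0 \<le> z \<longrightarrow> x \<le> z)"
proof
  assume x: "i x \<le> sup (i a) 0"
  show "\<forall>z. a \<le> z \<and> 0 \<le> z \<longrightarrow> x \<le> z"
  proof (intro allI impI)
    fix z assume "a \<le> z \<and> 0 \<le> z"
    then have "i a \<le> i z" "i 0 \<le> i z" by (simp_all add: cover_le_iff[OF cover])
    then have "sup (i a) 0 \<le> i z" by (simp add: cover_zero[OF cover])
    with x have "i x \<le> i z" by (rule order.trans)
    then show "x \<le> z" by (simp add: cover_le_iff[OF cover])
  qed
next
  assume x: "\<forall>z. a \<le> z \<and> 0 \<le> z \<longrightarrow> x \<le> z"
  show "i x \<le> sup (i a) 0"
  proof (rule cover_le_infI[OF cover])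
    fix z assume "sup (i a) 0 \<le> i z"
    then have "i a \<le> i z" "i 0 \<le> i z" by (simp_all add: cover_zero[OF cover])
    with x show "i x \<le> i z" by (simp add: cover_le_iff[OF cover])
  qed
qed

text \<open>The condition that every \<open>a\<close> with \<open>\<not> a \<le> 0\<close> admits \<open>x > 0\<close> lying below all common upper
  bounds of \<open>a\<close> and \<open>0\<close> makes no reference to a cover; it is equivalent to pervasiveness with
  respect to any cover.\<close>

lemma pervasive_cover_independent:
  fixes i :: "'x::ordered_real_vector \<Rightarrow> 'y::vector_lattice"
    and j :: "'x \<Rightarrow> 'z::vector_lattice"
  assumes perv: "pervasive_via j" and cover: "vector_lattice_cover i"
  shows "pervasive_via i"
  unfolding pervasive_via_def
proof (intro conjI allI impI cover)
  have j: "vector_lattice_cover j" using perv by (simp add: pervasive_via_def)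
  fix y :: 'y
  assume y: "0 \<le> y \<and> y \<noteq> 0"
  have "\<not> y \<le> 0" using y by (auto intro: order.antisym)
  then obtain a where a: "i a \<le> y" "\<not> i a \<le> 0"
    using cover_sup_leI[OF cover, of y 0] by blast
  then have "\<not> a \<le> 0" by (metis cover_le_iff[OF cover] cover_zero[OF cover])
  then have "\<not> j a \<le> 0" by (metis cover_le_iff[OF j] cover_zero[OF j])
  then have "sup (j a) 0 \<noteq> 0" by (metis sup_ge1)
  then obtain x where x: "0 < j x" "j x \<le> sup (j a) 0"
    using perv unfolding pervasive_via_def by (meson sup_ge2)
  then have "i x \<le> sup (i a) 0"
    by (simp add: cover_le_positive_part_iff[OF cover] cover_le_positive_part_iff[OF j])
  also have "\<dots> \<le> y" using a y by simp
  finally show "\<exists>x. 0 < i x \<and> i x \<le> y"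
    using x(1) by (auto simp: cover_less_zero_iff[OF cover] cover_less_zero_iff[OF j])
qed

lemma pervasiveD:
  assumes "pervasive_via i" "0 < y"
  obtains x where "0 < i x" "i x \<le> y"
  using assms unfolding pervasive_via_def by (metis less_le)

lemma cover_disjointD:
  assumes cover: "vector_lattice_cover i" and disj: "disjoint_elems (i x) (i z)"
  shows "disjoint_elems x z"
proof -
  note lin = cover_linear[OF cover]
  have "x + z \<le> w \<and> - x - z \<le> w \<longleftrightarrow> x - z \<le> w \<and> - x + z \<le> w" for w
  proof -
    have "i w \<in> ubs UNIV {i x + i z, - i x - i z} \<longleftrightarrow> i w \<in> ubs UNIV {i x - i z, - i x + i z}"
      using disj by (simp add: disjoint_elems_def)
    then show ?thesis
      unfolding mem_ubs_pair
      unfolding linear_add[OF lin, symmetric] linear_neg[OF lin, symmetric]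
        linear_diff[OF lin, symmetric] cover_le_iff[OF cover] .
  qed
  then show ?thesis by (simp add: disjoint_elems_def set_eq_iff mem_ubs_pair)
qed

section \<open>Atoms and discrete elements in pervasive spaces\<close>

lemma discrete_imp_discrete_cover:
  assumes perv: "pervasive_via i" and disc: "discrete_elem a"
  shows "discrete_elem (i a)"
  unfolding discrete_elem_def
proof (intro conjI allI impI)
  have cover: "vector_lattice_cover i" using perv by (simp add: pervasive_via_def)
  show "0 < i a" using disc by (simp add: discrete_elem_def cover_less_zero_iff[OF cover])
  fix u v
  assume h: "0 \<le> u \<and> 0 \<le> v \<and> u \<le> i a \<and> v \<le> i a \<and> disjoint_elems u v"
  show "u = 0 \<or> v = 0"
  proof (rule ccontr)
    assume "\<not> (u = 0 \<or> v = 0)"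
    then have uv: "0 < u" "0 < v" using h by auto
    obtain x where x: "0 < i x" "i x \<le> u" using pervasiveD[OF perv uv(1)] by blast
    obtain z where z: "0 < i z" "i z \<le> v" using pervasiveD[OF perv uv(2)] by blast
    have "inf (i x) (i z) \<le> inf u v" using x z by (intro inf_mono)
    also have "\<dots> = 0" using h by (intro disjoint_positive_imp_inf_zero) auto
    finally have "inf (i x) (i z) = 0" using x(1) z(1) by (meson order.antisym inf_greatest less_imp_le)
    then have "disjoint_elems (i x) (i z)" using x z by (intro inf_zero_imp_disjoint) auto
    then have "disjoint_elems x z" by (rule cover_disjointD[OF cover])
    moreover have "0 < x" "0 < z" using x z by (simp_all add: cover_less_zero_iff[OF cover])
    moreover have "i x \<le> i a" "i z \<le> i a" using x z h by (blast intro: order.trans)+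
    then have "x \<le> a" "z \<le> a" by (simp_all add: cover_le_iff[OF cover])
    ultimately show False using disc unfolding discrete_elem_def by (metis less_le)
  qed
qed

lemma atom_cover_imp_atom:
  assumes cover: "vector_lattice_cover i" and "i a \<in> atoms"
  shows "a \<in> atoms"
proof -
  note lin = cover_linear[OF cover]
  have "\<exists>c\<ge>0. x = c *\<^sub>R a" if "0 \<le> x" "x \<le> a" for x
  proof -
    have "i 0 \<le> i x" "i x \<le> i a" using that by (simp_all add: cover_le_iff[OF cover])
    then obtain c where "0 \<le> c" "i x = c *\<^sub>R i a"
      using atomD[OF assms(2)] unfolding cover_zero[OF cover] by blast
    then have "i x = i (c *\<^sub>R a)" by (simp add: linear_cmul[OF lin])
    then have "x = c *\<^sub>R a" by (simp only: cover_eq_iff[OF cover])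
    with \<open>0 \<le> c\<close> show ?thesis by blast
  qed
  moreover have "0 < a" using atom_pos[OF assms(2)] by (simp add: cover_less_zero_iff[OF cover])
  ultimately show ?thesis by (auto simp: atoms_def)
qed

lemma atom_of_cover_in_range:
  assumes perv: "pervasive_via i" and b: "b \<in> atoms"
  shows "b \<in> range i"
proof -
  have lin: "linear i" using perv by (simp add: pervasive_via_def cover_linear)
  obtain x where x: "0 < i x" "i x \<le> b" using pervasiveD[OF perv atom_pos[OF b]] by blast
  then obtain c where c: "i x = c *\<^sub>R b" by (meson atomD[OF b] less_imp_le)
  with x(1) have "c \<noteq> 0" by auto
  with c have "b = i (x /\<^sub>R c)" by (simp add: linear_cmul[OF lin])
  then show ?thesis by blast
qed

theorem theorem32:
  fixes i :: "'x::ordered_real_vector \<Rightarrow> 'y::vector_lattice"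
    and j :: "'x \<Rightarrow> 'z::vector_lattice"
    and a :: 'x
  assumes "archimedean_ovs TYPE('x)"
    and "pervasive_via j"
    and "vector_lattice_cover i"
  shows "(a \<in> atoms \<longleftrightarrow> i a \<in> atoms) \<and>
    (discrete_elem a \<longleftrightarrow> discrete_elem (i a)) \<and>
    (a \<in> atoms \<longleftrightarrow> discrete_elem a) \<and>
    (a \<in> atoms \<longrightarrow> i ` ideal_of a = ideal_of (i a)) \<and>
    (\<forall>b::'y. b \<in> atoms \<longrightarrow> b \<in> range i \<and> inv i b \<in> atoms)"
proof -
  have perv: "pervasive_via i"
    using assms(2,3) by (rule pervasive_cover_independent)
  have arch: "archimedean_ovs TYPE('y)"
    using assms(3,1) by (rule cover_archimedean)
  have cycle: "a \<in> atoms \<Longrightarrow> discrete_elem a"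
    "discrete_elem a \<Longrightarrow> discrete_elem (i a)"
    "discrete_elem (i a) \<Longrightarrow> i a \<in> atoms"
    "i a \<in> atoms \<Longrightarrow> a \<in> atoms"
    by (fact atom_imp_discrete discrete_imp_discrete_cover[OF perv]
        discrete_imp_atom[OF arch] atom_cover_imp_atom[OF assms(3)])+
  have "i ` ideal_of a = ideal_of (i a)" if "a \<in> atoms"
    using that cycle linear_span_image[OF cover_linear[OF assms(3)], of "{a}"]
    by (simp add: ideal_of_atom)
  moreover have "b \<in> range i \<and> inv i b \<in> atoms" if b: "b \<in> atoms" for b
  proof -
    have "b \<in> range i" using perv b by (rule atom_of_cover_in_range)
    moreover from this have "i (inv i b) \<in> atoms" using b by (simp add: f_inv_into_f)
    ultimately show ?thesis using atom_cover_imp_atom[OF assms(3)] by blast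
  qed
  ultimately show ?thesis using cycle by blast
qed

end
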